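(* For any rational number $t > 1/2$, there exists no minimally $t$-tough, wheel-free graph with a universal vertex.
   Context: All graphs are finite, simple and undirected. $\omega(H)$ denotes the number of connected components of a graph $H$. For a real number $t$, a graph $G$ is $t$-tough if $|S| \ge t\cdot\omega(G-S)$ for every $S \subseteq V(G)$ with $\omega(G-S) > 1$. The toughness $\tau(G)$ is the largest $t$ for which $G$ is $t$-tough, where $\tau(K_n)=\infty$ for all $n\ge 1$. A graph $G$ is minimally $t$-tough if $\tau(G)=t$ and $\tau(G-e)<t$ for every $e\in E(G)$. A universal vertex is a vertex adjacent to all the other vertices. For $n\ge 5$, the wheel graph $W_n$ on $n$ vertices is the graph obtained from a cycle on $n-1\ge 4$ vertices by adding a universal vertex. A graph is wheel-free if it contains no induced subgraph isomorphic to $W_n$ for any $n\ge 5$. *)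

theory Defs
  imports "HOL-Library.Extended_Real" "Graph_Theory.Graph_Theory"
begin

text \<open>
  A finite simple undirected graph is a \<^locale>\<open>pair_graph\<close>: an edge between \<open>u\<close> and \<open>v\<close>
  is the pair of arcs \<open>(u, v)\<close>, \<open>(v, u)\<close>. In such a symmetric digraph the strongly
  connected components are the connected components of the undirected graph.
\<close>

definition num_components :: "('a, 'b) pre_digraph \<Rightarrow> nat" where
  "num_components G = card (pre_digraph.sccs G)"

definition tough :: "real \<Rightarrow> ('a, 'b) pre_digraph \<Rightarrow> bool" where
  "tough t G \<longleftrightarrow> (\<forall>S \<subseteq> verts G. num_components (G \<restriction> (verts G - S)) > 1 \<longrightarrow>
     real (card S) \<ge> t * real (num_components (G \<restriction> (verts G - S))))"

text \<open>
  A finite graph that is not complete has a cutset or is disconnected, and only finitely many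
  sets \<open>S\<close> matter, so the greatest \<open>t\<close> exists. For complete graphs every \<open>t\<close> qualifies and
  the value is infinite by convention (the null graph is included here).
\<close>
definition toughness :: "('a, 'b) pre_digraph \<Rightarrow> ereal" where
  "toughness G = (if \<exists>n. complete_digraph n G then \<infinity> else ereal (GREATEST t. tough t G))"

definition delete_edge :: "'a pair_pre_digraph \<Rightarrow> 'a \<times> 'a \<Rightarrow> 'a pair_pre_digraph" where
  "delete_edge G e = G\<lparr>parcs := parcs G - {e, prod.swap e}\<rparr>"

definition minimally_tough :: "real \<Rightarrow> 'a pair_pre_digraph \<Rightarrow> bool" where
  "minimally_tough t G \<longleftrightarrow> toughness (with_proj G) = ereal t \<and>
     (\<forall>e \<in> parcs G. toughness (with_proj (delete_edge G e)) < ereal t)"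

definition universal_vertex :: "'a pair_pre_digraph \<Rightarrow> 'a \<Rightarrow> bool" where
  "universal_vertex G v \<longleftrightarrow> v \<in> pverts G \<and> (\<forall>u \<in> pverts G - {v}. (v, u) \<in> parcs G)"

definition cycle_graph :: "nat \<Rightarrow> nat pair_pre_digraph" where
  "cycle_graph m = \<lparr>pverts = {..<m},
     parcs = {(i, j). i < m \<and> j < m \<and> (j = Suc i mod m \<or> i = Suc j mod m)}\<rparr>"

text \<open>
  The wheel on \<open>n\<close> vertices, for \<open>n \<ge> 5\<close>: the rim is the cycle on \<open>0, \<dots>, n - 2\<close> and
  the hub is \<open>n - 1\<close>.
\<close>
definition wheel_graph :: "nat \<Rightarrow> nat pair_pre_digraph" where
  "wheel_graph n = (let C = cycle_graph (n - 1); h = n - 1 in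
     \<lparr>pverts = insert h (pverts C),
      parcs = parcs C \<union> {h} \<times> pverts C \<union> pverts C \<times> {h}\<rparr>)"

definition wheel_free :: "'a pair_pre_digraph \<Rightarrow> bool" where
  "wheel_free G \<longleftrightarrow> \<not> (\<exists>n \<ge> 5. \<exists>H. induced_subgraph H (with_proj G) \<and>
     digraph_iso H (with_proj (wheel_graph n)))"

end

theory Submission
  imports Defs
begin

text \<open>
  Let \<open>v\<close> be a universal vertex. Toughness forces every non-universal vertex to have degree at
  least \<open>2 * t\<close>, while deleting the edge \<open>vu\<close> can only lower the toughness below \<open>t\<close> if \<open>u\<close> has
  degree less than \<open>2 * t + 1\<close>. Hence \<open>v\<close> is the only universal vertex and \<open>G - v\<close> is regular.
  Wheel-freeness makes \<open>G - v\<close> chordal, so it has a simplicial vertex, whose closed neighbourhood is,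
  by regularity, a connected component of \<open>G - v\<close>. So \<open>{v}\<close> is a cutset, and \<open>1 \<ge> 2 * t\<close>.
\<close>

section \<open>Chordless paths, induced cycles and simplicial vertices\<close>

text \<open>The successor condition modulo \<open>m\<close> is the one in
  \<open>cycle_graph\<close>, so the rim of a wheel can be matched with \<open>p\<close> index by
  index. The equivalence, rather than an implication, rules out chords.\<close>

definition induced_cycle :: "'a rel \<Rightarrow> nat \<Rightarrow> (nat \<Rightarrow> 'a) \<Rightarrow> bool" where
  "induced_cycle E m p \<longleftrightarrow> inj_on p {..<m} \<and>
     (\<forall>i<m. \<forall>j<m. (p i, p j) \<in> E \<longleftrightarrow> j = Suc i mod m \<or> i = Suc j mod m)"

definition connected_on :: "'a rel \<Rightarrow> 'a set \<Rightarrow> bool" where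
  "connected_on E A \<longleftrightarrow> (\<forall>x\<in>A. \<forall>y\<in>A. (x, y) \<in> (E \<inter> A \<times> A)\<^sup>*)"

lemma connected_on_insert:
  assumes "sym E" "connected_on E A" "a \<in> A" "(a, s) \<in> E"
  shows "connected_on E (insert s A)"
proof -
  let ?R = "E \<inter> insert s A \<times> insert s A"
  have sub: "(E \<inter> A \<times> A)\<^sup>* \<subseteq> ?R\<^sup>*"
    by (rule rtrancl_mono) blast
  have fwd: "(x, a) \<in> ?R\<^sup>*" and bwd: "(a, x) \<in> ?R\<^sup>*" if "x \<in> insert s A" for x
  proof -
    have "(a, s) \<in> ?R" "(s, a) \<in> ?R" using assms by (auto dest: symD)
    then show "(x, a) \<in> ?R\<^sup>*" "(a, x) \<in> ?R\<^sup>*"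
      using that assms(2,3) sub unfolding connected_on_def by auto
  qed
  show ?thesis unfolding connected_on_def using fwd bwd by (meson rtrancl_trans)
qed

text \<open>A walk of minimal length within \<open>W\<close> works: a repeated vertex or a chord
  would give a shorter one.\<close>

lemma chordless_path:
  assumes "sym E" "irrefl E" "s \<in> W" "(s, s') \<in> (E \<inter> W \<times> W)\<^sup>*"
  obtains n f where "f 0 = s" "f n = s'" "\<And>i. i \<le> n \<Longrightarrow> f i \<in> W" "inj_on f {..n}"
    "\<And>i j. i \<le> n \<Longrightarrow> j \<le> n \<Longrightarrow> (f i, f j) \<in> E \<longleftrightarrow> j = Suc i \<or> i = Suc j"
proof -
  let ?R = "E \<inter> W \<times> W"
  define n where "n = (LEAST k. (s, s') \<in> ?R ^^ k)"
  have "\<exists>k. (s, s') \<in> ?R ^^ k" using assms(4) by (simp add: rtrancl_power)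
  then have n: "(s, s') \<in> ?R ^^ n" unfolding n_def by (rule LeastI_ex)
  have least: "n \<le> k" if "(s, s') \<in> ?R ^^ k" for k
    unfolding n_def using that by (rule Least_le)
  from n obtain f where f0: "f 0 = s" and fn: "f n = s'"
    and step: "\<And>i. i < n \<Longrightarrow> (f i, f (Suc i)) \<in> ?R"
    by (auto simp: relpow_fun_conv)
  have W: "f i \<in> W" if "i \<le> n" for i
  proof (cases i)
    case 0 then show ?thesis using f0 assms(3) by simp
  next
    case (Suc k) then show ?thesis using step[of k] that by auto
  qed
  have seg: "(f i, f (i + k)) \<in> ?R ^^ k" if "i + k \<le> n" for i k
  proof -
    have "(f (i + l), f (i + Suc l)) \<in> ?R" if "l < k" for l
      using step[of "i + l"] that \<open>i + k \<le> n\<close> by simp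
    then show ?thesis unfolding relpow_fun_conv by (intro exI[of _ "\<lambda>l. f (i + l)"]) simp
  qed
  \<comment> \<open>Replacing the segment from \<open>f i\<close> to \<open>f j\<close> by a walk of
    \<open>k\<close> steps gives total length \<open>i + k + (n - j)\<close>, which is at least
    \<open>n\<close>. The case \<open>k = 0\<close> yields injectivity, the case
    \<open>k = 1\<close> the absence of chords.\<close>
  have short: "j \<le> i + k" if "j \<le> n" "i \<le> n" "(f i, f j) \<in> ?R ^^ k" for i j k
  proof -
    have "(s, f i) \<in> ?R ^^ i" using seg[of 0 i] that f0 by simp
    moreover have "(f j, s') \<in> ?R ^^ (n - j)" using seg[of j "n - j"] that fn by simp
    ultimately have "(s, s') \<in> ?R ^^ (i + k + (n - j))"
      using that(3) by (auto simp: relpow_add)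
    then show ?thesis using least that(1) by fastforce
  qed
  have inj: "inj_on f {..n}"
  proof (rule inj_onI)
    fix i j assume "i \<in> {..n}" "j \<in> {..n}" "f i = f j"
    then show "i = j" using short[of i j 0] short[of j i 0] by auto
  qed
  have adj: "(f i, f j) \<in> E \<longleftrightarrow> j = Suc i \<or> i = Suc j" if "i \<le> n" "j \<le> n" for i j
  proof
    assume e: "(f i, f j) \<in> E"
    then have "(f i, f j) \<in> ?R" "(f j, f i) \<in> ?R" using W that assms(1) by (auto dest: symD)
    then have "j \<le> i + 1" "i \<le> j + 1" using short[of i j 1] short[of j i 1] that by auto
    moreover have "i \<noteq> j" using e assms(2) by (auto simp: irrefl_def)
    ultimately show "j = Suc i \<or> i = Suc j" by auto
  next
    assume "j = Suc i \<or> i = Suc j"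
    then show "(f i, f j) \<in> E" using step[of i] step[of j] that assms(1) by (auto dest: symD)
  qed
  show thesis using that[OF f0 fn W inj adj] .
qed

text \<open>The new vertex \<open>b\<close> gets index \<open>n + 1\<close>, whose cyclic neighbours
  are \<open>n\<close> and \<open>0\<close>, the two ends of the path.\<close>

lemma induced_cycle_of_chordless_path:
  assumes E: "sym E" "irrefl E" and n: "n \<ge> 1"
    and f: "inj_on f {..n}"
      "\<And>i j. i \<le> n \<Longrightarrow> j \<le> n \<Longrightarrow> (f i, f j) \<in> E \<longleftrightarrow> j = Suc i \<or> i = Suc j"
    and b: "b \<notin> f ` {..n}" "\<And>i. i \<le> n \<Longrightarrow> (b, f i) \<in> E \<longleftrightarrow> i = 0 \<or> i = n"
  shows "induced_cycle E (n + 2) (f(Suc n := b))"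
proof -
  let ?p = "f(Suc n := b)"
  have b': "(f i, b) \<in> E \<longleftrightarrow> i = 0 \<or> i = n" if "i \<le> n" for i
    using b(2)[OF that] E(1) by (auto dest: symD)
  have bb: "(b, b) \<notin> E" using E(2) by (auto simp: irrefl_def)
  have "inj_on ?p {..<n + 2}"
  proof -
    have "{..<n + 2} = insert (Suc n) {..n}" by auto
    then show ?thesis using f(1) b(1) by (auto simp: inj_on_def)
  qed
  moreover have "(?p i, ?p j) \<in> E \<longleftrightarrow> j = Suc i mod (n + 2) \<or> i = Suc j mod (n + 2)"
    if "i < n + 2" "j < n + 2" for i j
  proof -
    \<comment> \<open>Wrapping around happens only at the index of \<open>b\<close>.\<close>
    have m: "Suc k mod (n + 2) = (if k = Suc n then 0 else Suc k)" if "k < n + 2" for k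
      using that by auto
    consider "i \<le> n" "j \<le> n" | "i = Suc n" "j \<le> n" | "i \<le> n" "j = Suc n" | "i = Suc n" "j = Suc n"
      using \<open>i < n + 2\<close> \<open>j < n + 2\<close> by linarith
    then show ?thesis
      unfolding m[OF that(1)] m[OF that(2)]
      by cases (use f(2) b(2) b' bb n in auto)
  qed
  ultimately show ?thesis unfolding induced_cycle_def by blast
qed

text \<open>
  Take a maximal connected \<open>A\<close> whose closed neighbourhood is not all of \<open>U\<close>, let \<open>S\<close> be its
  neighbourhood and \<open>B\<close> the rest. By maximality \<open>S\<close> is complete to \<open>B\<close>, and it is a clique, since a
  shortest path through \<open>A\<close> between non-adjacent vertices of \<open>S\<close> closes up to an induced cycle
  through any vertex of \<open>B\<close>. So a simplicial vertex of \<open>B\<close> is simplicial in \<open>U\<close>.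
\<close>
lemma simplicial_vertex_exists:
  assumes E: "sym E" "irrefl E" and "finite U" "U \<noteq> {}"
    and "\<And>m p. m \<ge> 4 \<Longrightarrow> p ` {..<m} \<subseteq> U \<Longrightarrow> \<not> induced_cycle E m p"
  shows "\<exists>x\<in>U. \<forall>y\<in>U. \<forall>z\<in>U. (x, y) \<in> E \<longrightarrow> (x, z) \<in> E \<longrightarrow> y \<noteq> z \<longrightarrow> (y, z) \<in> E"
  using assms(3-5)
proof (induction U rule: finite_psubset_induct)
  case (psubset U)
  define nb where "nb A = {s \<in> U - A. \<exists>a\<in>A. (a, s) \<in> E}" for A
  define ok where "ok A \<longleftrightarrow> A \<subseteq> U \<and> A \<noteq> {} \<and> connected_on E A \<and> U - A - nb A \<noteq> {}" for A
  show ?case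
  proof (cases "\<exists>x\<in>U. \<exists>y\<in>U. x \<noteq> y \<and> (x, y) \<notin> E")
    case False
    then show ?thesis using psubset.prems(1) by blast
  next
    case True
    then obtain x y where xy: "x \<in> U" "y \<in> U" "x \<noteq> y" "(x, y) \<notin> E" by blast
    \<comment> \<open>The vertex \<open>y\<close> lies outside the closed neighbourhood of
      \<open>x\<close>, so there is a candidate from which to reach a maximal one.\<close>
    then have "ok {x}" unfolding ok_def nb_def connected_on_def by auto
    moreover have "finite {A. ok A}"
      by (rule finite_subset[of _ "Pow U"]) (use psubset.hyps in \<open>auto simp: ok_def\<close>)
    ultimately obtain A where A: "ok A" and max: "\<And>A'. ok A' \<Longrightarrow> A \<subseteq> A' \<Longrightarrow> A' = A"
      using finite_has_maximal[of "{A. ok A}"] by auto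
    define S where "S = nb A"
    define B where "B = U - A - S"
    have AU: "A \<subseteq> U" and Ane: "A \<noteq> {}" and Ac: "connected_on E A" and Bne: "B \<noteq> {}"
      using A unfolding ok_def B_def S_def by auto
    have SU: "S \<subseteq> U - A" and Sadj: "\<And>s. s \<in> S \<Longrightarrow> \<exists>a\<in>A. (a, s) \<in> E"
      unfolding S_def nb_def by auto
    have nAB: "(a, b) \<notin> E" "(b, a) \<notin> E" if "a \<in> A" "b \<in> B" for a b
      using that E(1) unfolding B_def S_def nb_def by (auto dest: symD)
    have SB: "(s, b) \<in> E" "(b, s) \<in> E" if s: "s \<in> S" and bB: "b \<in> B" for s b
    proof -
      obtain a where a: "a \<in> A" "(a, s) \<in> E" using Sadj s by blast
      \<comment> \<open>The larger set \<open>insert s A\<close> cannot be \<open>ok\<close>, and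
        the only condition that can fail is that some vertex remains outside its closed
        neighbourhood. So \<open>b\<close> has a neighbour in \<open>insert s A\<close>, which must
        be \<open>s\<close>, as \<open>b\<close> has none in \<open>A\<close>.\<close>
      have "connected_on E (insert s A)" using connected_on_insert[OF E(1) Ac a] .
      moreover have "insert s A \<noteq> A" using s SU by blast
      ultimately have "U - insert s A - nb (insert s A) = {}"
        using max[of "insert s A"] AU SU s unfolding ok_def by blast
      moreover have "b \<in> U" "b \<notin> insert s A" using bB s unfolding B_def by auto
      ultimately have "b \<in> nb (insert s A)" by blast
      then show "(s, b) \<in> E" using nAB bB unfolding nb_def by auto
      then show "(b, s) \<in> E" using E(1) by (auto dest: symD)
    qed
    have clique: "(s, s') \<in> E" if s: "s \<in> S" "s' \<in> S" "s \<noteq> s'" for s s'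
    proof (rule ccontr)
      assume ns: "(s, s') \<notin> E"
      obtain b where b: "b \<in> B" using Bne by blast
      obtain a a' where a: "a \<in> A" "(a, s) \<in> E" and a': "a' \<in> A" "(a', s') \<in> E"
        using Sadj s by meson
      let ?W = "insert s' (insert s A)"
      have "connected_on E ?W"
        using connected_on_insert[OF E(1) connected_on_insert[OF E(1) Ac a] _ a'(2)] a'(1) by blast
      then have path: "(s, s') \<in> (E \<inter> ?W \<times> ?W)\<^sup>*" unfolding connected_on_def by blast
      obtain n f where f: "f 0 = s" "f n = s'" "\<And>i. i \<le> n \<Longrightarrow> f i \<in> ?W" "inj_on f {..n}"
        "\<And>i j. i \<le> n \<Longrightarrow> j \<le> n \<Longrightarrow> (f i, f j) \<in> E \<longleftrightarrow> j = Suc i \<or> i = Suc j"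
        by (rule chordless_path[OF E _ path]) auto
      \<comment> \<open>The path has at least two edges because \<open>s\<close> and
        \<open>s'\<close> are distinct and non-adjacent. Hence the cycle through \<open>b\<close>
        has \<open>n + 2 \<ge> 4\<close> vertices.\<close>
      have "n \<noteq> 0" using f(1,2) s(3) by (cases n) auto
      moreover have "n \<noteq> 1" using f(1,2) f(5)[of 0 1] ns by auto
      ultimately have n2: "n \<ge> 2" by simp
      \<comment> \<open>By injectivity the interior of the path avoids \<open>s\<close> and
        \<open>s'\<close>, so it stays in \<open>A\<close>, where \<open>b\<close> has no
        neighbours.\<close>
      have ends: "f i \<in> A" if "i \<le> n" "i \<noteq> 0" "i \<noteq> n" for i
      proof -
        have "f i \<noteq> f 0" "f i \<noteq> f n" using f(4) that by (auto dest: inj_onD)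
        then show ?thesis using f(1-3) that by auto
      qed
      have bW: "b \<notin> ?W" using b s unfolding B_def by auto
      have "induced_cycle E (n + 2) (f(Suc n := b))"
      proof (rule induced_cycle_of_chordless_path[OF E _ f(4,5)])
        show "b \<notin> f ` {..n}" using f(3) bW by auto
        show "(b, f i) \<in> E \<longleftrightarrow> i = 0 \<or> i = n" if "i \<le> n" for i
          using ends[OF that] nAB b SB s f(1,2) by blast
      qed (use n2 in auto)
      moreover have "(f(Suc n := b)) ` {..<n + 2} \<subseteq> U"
      proof -
        have "?W \<subseteq> U" "b \<in> U" using s SU AU b unfolding B_def by auto
        then have "f i \<in> U" if "i \<le> n" for i using f(3)[OF that] by blast
        then show ?thesis using \<open>b \<in> U\<close> by auto
      qed
      ultimately show False using psubset.prems(2)[of "n + 2"] n2 by auto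
    qed
    have "B \<subset> U" using AU Ane unfolding B_def by blast
    then have "\<exists>x\<in>B. \<forall>y\<in>B. \<forall>z\<in>B. (x, y) \<in> E \<longrightarrow> (x, z) \<in> E \<longrightarrow> y \<noteq> z \<longrightarrow> (y, z) \<in> E"
      by (rule psubset.IH) (use Bne psubset.prems(2) \<open>B \<subset> U\<close> in auto)
    then obtain x where x: "x \<in> B"
      "\<forall>y\<in>B. \<forall>z\<in>B. (x, y) \<in> E \<longrightarrow> (x, z) \<in> E \<longrightarrow> y \<noteq> z \<longrightarrow> (y, z) \<in> E"
      by blast
    have "(y, z) \<in> E" if yz: "y \<in> U" "z \<in> U" "(x, y) \<in> E" "(x, z) \<in> E" "y \<noteq> z" for y z
    proof -
      \<comment> \<open>No neighbour of \<open>x\<close> lies in \<open>A\<close>. Two neighbours in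
        \<open>B\<close> are adjacent by the choice of \<open>x\<close>, two in \<open>S\<close>
        because \<open>S\<close> is a clique, and a mixed pair because \<open>S\<close> is complete
        to \<open>B\<close>.\<close>
      have "y \<in> S \<union> B" "z \<in> S \<union> B" using yz nAB x(1) unfolding B_def by auto
      then show ?thesis using x(2) yz SB clique by blast
    qed
    moreover have "x \<in> U" using x(1) B_def by blast
    ultimately show ?thesis by blast
  qed
qed

section \<open>Induced wheels from induced cycles\<close>

text \<open>The isomorphism onto \<open>W\<close> is the inverse of \<open>q\<close> on vertices,
  applied to both ends of each arc. This reduces finding an induced wheel to giving an embedding
  that preserves and reflects adjacency.\<close>

lemma digraph_iso_of_induced_copy:
  assumes G: "pair_wf_digraph G" and W: "pair_wf_digraph W"
    and q: "inj_on q (pverts W)" "q ` pverts W \<subseteq> pverts G"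
    and adj: "\<And>i j. i \<in> pverts W \<Longrightarrow> j \<in> pverts W \<Longrightarrow> (q i, q j) \<in> parcs G \<longleftrightarrow> (i, j) \<in> parcs W"
  shows "\<exists>H. induced_subgraph H (with_proj G) \<and> digraph_iso H (with_proj W)"
proof -
  interpret G: pair_wf_digraph G by fact
  interpret W: pair_wf_digraph W by fact
  define H where "H = with_proj G \<restriction> (q ` pverts W)"
  define g where "g = the_inv_into (pverts W) q"
  define hom where "hom = \<lparr>iso_verts = g, iso_arcs = map_prod g g, iso_head = snd, iso_tail = fst\<rparr>"
  have gq: "g (q i) = i" if "i \<in> pverts W" for i
    unfolding g_def using q(1) that by (rule the_inv_into_f_f)
  have verts: "verts H = q ` pverts W"
    unfolding H_def by simp
  have arcs: "arcs H = map_prod q q ` parcs W"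
  proof
    show "arcs H \<subseteq> map_prod q q ` parcs W"
    proof
      fix e assume "e \<in> arcs H"
      then obtain i j where "e = (q i, q j)" "i \<in> pverts W" "j \<in> pverts W" "(q i, q j) \<in> parcs G"
        unfolding H_def by (cases e) (auto simp: induce_subgraph_def)
      then show "e \<in> map_prod q q ` parcs W" using adj by force
    qed
    show "map_prod q q ` parcs W \<subseteq> arcs H"
      unfolding H_def using adj W.in_arcsD1 W.in_arcsD2 by (auto simp: induce_subgraph_def)
  qed
  have ends: "tail H = fst" "head H = snd"
    unfolding H_def by (simp_all add: induce_subgraph_def)
  have g_arcs: "map_prod g g (map_prod q q a) = a" if "a \<in> parcs W" for a
    using that gq W.in_arcsD1 W.in_arcsD2 by (cases a) auto
  have "pre_digraph.digraph_isomorphism H hom"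
    unfolding pre_digraph.digraph_isomorphism_def
  proof (intro conjI ballI)
    show "wf_digraph H" unfolding H_def by (rule G.wellformed_induce_subgraph)
    show "inj_on (iso_verts hom) (verts H)"
      unfolding verts hom_def by (rule inj_on_inverseI[of _ q]) (use gq in auto)
    show "inj_on (iso_arcs hom) (arcs H)"
      unfolding arcs hom_def by (rule inj_on_inverseI[of _ "map_prod q q"]) (use g_arcs in auto)
  qed (auto simp: hom_def ends)
  moreover have "with_proj W = app_iso hom H"
  proof -
    have "g ` q ` pverts W = pverts W" using gq by (force simp: image_image)
    moreover have "map_prod g g ` map_prod q q ` parcs W = parcs W"
      using g_arcs by (force simp: image_image)
    ultimately show ?thesis
      by (simp add: app_iso_def with_proj_def hom_def verts arcs)
  qed
  ultimately have "digraph_iso H (with_proj W)" unfolding digraph_iso_def by blast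
  moreover have "induced_subgraph H (with_proj G)"
    unfolding H_def by (rule G.induced_induce) (use q(2) in simp)
  ultimately show ?thesis by blast
qed

lemma pair_wf_digraph_wheel_graph: "pair_wf_digraph (wheel_graph n)"
  by unfold_locales (auto simp: wheel_graph_def cycle_graph_def Let_def)

text \<open>Such a cycle would be the rim of an induced wheel with hub \<open>v\<close> on
  \<open>Suc m \<ge> 5\<close> vertices.\<close>

lemma wheel_free_imp_no_induced_cycle:
  assumes "pair_graph G" "wheel_free G" "universal_vertex G v"
    and "m \<ge> 4" "p ` {..<m} \<subseteq> pverts G - {v}"
  shows "\<not> induced_cycle (parcs G) m p"
proof
  assume cyc: "induced_cycle (parcs G) m p"
  interpret pair_graph G by fact
  let ?W = "wheel_graph (Suc m)"
  \<comment> \<open>In \<open>wheel_graph (Suc m)\<close> the hub is the vertex \<open>m\<close>,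
    the first index beyond the rim.\<close>
  let ?q = "p(m := v)"
  have pv: "p i \<in> pverts G" "p i \<noteq> v" if "i < m" for i using assms(5) that by auto
  have hub: "(v, p i) \<in> parcs G" "(p i, v) \<in> parcs G" if "i < m" for i
    using assms(3) pv[OF that] arcs_symmetric unfolding universal_vertex_def by auto
  have W: "pverts ?W = {..m}"
    by (auto simp: wheel_graph_def cycle_graph_def Let_def)
  have "\<exists>H. induced_subgraph H (with_proj G) \<and> digraph_iso H (with_proj ?W)"
  proof (rule digraph_iso_of_induced_copy)
    show "pair_wf_digraph G" ..
    show "pair_wf_digraph ?W" by (rule pair_wf_digraph_wheel_graph)
    have "inj_on p {..<m}" using cyc unfolding induced_cycle_def by blast
    moreover have "{..m} = insert m {..<m}" by auto
    ultimately show "inj_on ?q (pverts ?W)"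
      unfolding W using pv(2) by (auto simp: inj_on_def)
    show "?q ` pverts ?W \<subseteq> pverts G"
      unfolding W using pv(1) assms(3) by (auto simp: universal_vertex_def)
    show "(?q i, ?q j) \<in> parcs G \<longleftrightarrow> (i, j) \<in> parcs ?W"
      if ij: "i \<in> pverts ?W" "j \<in> pverts ?W" for i j
    proof -
      consider "i < m" "j < m" | "i = m" "j < m" | "i < m" "j = m" | "i = m" "j = m"
        using ij unfolding W by force
      then show ?thesis
      proof cases
        case 1
        then show ?thesis using cyc
          by (simp add: induced_cycle_def wheel_graph_def cycle_graph_def Let_def)
      next
        case 4
        then show ?thesis using no_loops'
          by (auto simp: wheel_graph_def cycle_graph_def Let_def)
      qed (use hub in \<open>auto simp: wheel_graph_def cycle_graph_def Let_def\<close>)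
    qed
  qed
  moreover have "Suc m \<ge> 5" using assms(4) by simp
  ultimately show False using assms(2) unfolding wheel_free_def by blast
qed

section \<open>Bounds on the number of components\<close>

lemma num_components_conv_scc_of:
  assumes "wf_digraph H"
  shows "num_components H = card (pre_digraph.scc_of H ` verts H)"
proof -
  interpret wf_digraph H by fact
  show ?thesis
    unfolding num_components_def by (simp flip: card_sccs_verts add: sccs_verts_conv_scc_of)
qed

text \<open>Nothing outside \<open>A\<close> is reachable from \<open>x\<close>, so \<open>x\<close>
  and \<open>y\<close> lie in different strong components.\<close>

lemma num_components_gt_1:
  assumes "wf_digraph H" "finite (verts H)" "x \<in> verts H" "y \<in> verts H" "x \<in> A" "y \<notin> A"
    and closed: "\<And>a b. a \<in> A \<Longrightarrow> (a, b) \<in> arcs_ends H \<Longrightarrow> b \<in> A"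
  shows "num_components H > 1"
proof -
  interpret wf_digraph H by fact
  have "z \<in> A" if "x \<rightarrow>\<^sup>*\<^bsub>H\<^esub> z" for z
    using that by (induction rule: reachable_induct) (use assms(5) closed in auto)
  then have "scc_of x \<noteq> scc_of y"
    using assms(4,6) in_scc_of_self[of y] by (auto simp: scc_of_def)
  then have "card {scc_of x, scc_of y} = 2" by simp
  moreover have "card {scc_of x, scc_of y} \<le> card (scc_of ` verts H)"
    by (rule card_mono) (use assms in auto)
  ultimately show ?thesis
    using num_components_conv_scc_of[OF assms(1)] by simp
qed

text \<open>By symmetry, all vertices reachable from \<open>v\<close> share its component, and each
  exceptional vertex in \<open>X\<close> adds at most one more.\<close>

lemma num_components_le:
  assumes "wf_digraph H" "symmetric H" "finite X"
    and "\<And>w. w \<in> verts H \<Longrightarrow> w \<in> X \<or> v \<rightarrow>\<^sup>*\<^bsub>H\<^esub> w"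
  shows "num_components H \<le> Suc (card X)"
proof -
  interpret sym_digraph H by (intro sym_digraph.intro sym_digraph_axioms.intro assms)
  have "scc_of w = scc_of v" if "v \<rightarrow>\<^sup>*\<^bsub>H\<^esub> w" for w
    using scc_of_eq scc_ofI_reachable'[OF that] by blast
  then have "scc_of ` verts H \<subseteq> insert (scc_of v) (scc_of ` X)"
    using assms(4) by blast
  then have "card (scc_of ` verts H) \<le> card (insert (scc_of v) (scc_of ` X))"
    using assms(3) by (intro card_mono) auto
  also have "\<dots> \<le> Suc (card (scc_of ` X))" by (rule card_insert_le_m1) auto
  also have "\<dots> \<le> Suc (card X)" using assms(3) by (simp add: card_image_le)
  finally show ?thesis using num_components_conv_scc_of[OF assms(1)] by simp
qed

lemma arcs_ends_induce_with_proj: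
  "(a, b) \<in> arcs_ends (with_proj G \<restriction> T) \<longleftrightarrow> (a, b) \<in> parcs G \<and> a \<in> T \<and> b \<in> T"
  by (auto simp: arcs_ends_def arc_to_ends_def induce_subgraph_def)

section \<open>Toughness as a minimum over cutsets\<close>

text \<open>Being \<open>t\<close>-tough bounds \<open>t\<close> by one ratio for each cutset. There
  are finitely many cutsets and at least one, so the least ratio exists and is the greatest
  admissible \<open>t\<close>.\<close>

lemma tough_GREATEST:
  fixes H :: "('a, 'b) pre_digraph"
  assumes fin: "finite (verts H)"
    and cut: "S \<subseteq> verts H" "num_components (H \<restriction> (verts H - S)) > 1"
  shows "tough (GREATEST t. tough t H) H" and "tough t H \<Longrightarrow> t \<le> (GREATEST t. tough t H)"
proof -
  define r where "r S = real (card S) / real (num_components (H \<restriction> (verts H - S)))" for S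
  define C where "C = {S. S \<subseteq> verts H \<and> num_components (H \<restriction> (verts H - S)) > 1}"
  have iff: "tough t H \<longleftrightarrow> (\<forall>S\<in>C. t \<le> r S)" for t
    by (auto simp: tough_def C_def r_def pos_le_divide_eq)
  have "finite C" unfolding C_def using fin by simp
  moreover have "C \<noteq> {}" using cut unfolding C_def by blast
  ultimately have iff': "tough t H \<longleftrightarrow> t \<le> Min (r ` C)" for t
    unfolding iff by simp
  have "(GREATEST t. tough t H) = Min (r ` C)"
    by (rule Greatest_equality) (simp_all add: iff')
  then show "tough (GREATEST t. tough t H) H" "tough t H \<Longrightarrow> t \<le> (GREATEST t. tough t H)"
    by (simp_all add: iff')
qed

text \<open>Removing every vertex except \<open>x\<close> and \<open>y\<close> leaves two isolated
  vertices.\<close>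

lemma nonadjacent_imp_cutset:
  assumes "pair_wf_digraph G" "x \<in> pverts G" "y \<in> pverts G" "x \<noteq> y" "(x, y) \<notin> parcs G"
  shows "\<exists>S\<subseteq>pverts G. num_components (with_proj G \<restriction> (pverts G - S)) > 1"
proof (intro exI conjI)
  interpret pair_wf_digraph G by fact
  have T: "pverts G - (pverts G - {x, y}) = {x, y}" using assms by blast
  show "num_components (with_proj G \<restriction> (pverts G - (pverts G - {x, y}))) > 1"
    unfolding T using assms
    by (intro num_components_gt_1[where x = x and y = y and A = "{x}", OF wellformed_induce_subgraph])
      (auto simp: arcs_ends_induce_with_proj)
qed blast

text \<open>A non-adjacent pair excludes the infinite case and supplies a cutset, so the greatest
  value is attained, and admissible values are downward closed. Later arguments pass from
  \<open>toughness\<close> to \<open>tough\<close> through this equivalence.\<close>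

lemma nonadjacent_imp_toughness:
  fixes G :: "'a pair_pre_digraph"
  assumes "pair_wf_digraph G" "finite (pverts G)"
    and "x \<in> pverts G" "y \<in> pverts G" "x \<noteq> y" "(x, y) \<notin> parcs G"
  shows "\<exists>s. toughness (with_proj G) = ereal s \<and> (\<forall>t. tough t (with_proj G) \<longleftrightarrow> t \<le> s)"
proof -
  obtain S where S: "S \<subseteq> pverts G" "num_components (with_proj G \<restriction> (pverts G - S)) > 1"
    using nonadjacent_imp_cutset[OF assms(1,3-6)] by (elim exE conjE)
  let ?s = "GREATEST t. tough t (with_proj G)"
  have "\<not> complete_digraph n (with_proj G)" for n
    using assms(3-6) by (auto simp: complete_digraph_def)
  then have "toughness (with_proj G) = ereal ?s" unfolding toughness_def by simp
  moreover have "tough ?s (with_proj G)" "\<And>t. tough t (with_proj G) \<Longrightarrow> t \<le> ?s"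
    using tough_GREATEST[of "with_proj G" S] assms(2) S by simp_all
  moreover have "tough t (with_proj G)" if "tough s (with_proj G)" "t \<le> s" for t s
    using that unfolding tough_def by (meson mult_right_mono of_nat_0_le_iff order_trans)
  ultimately show ?thesis by blast
qed

lemma not_complete_imp_nonadjacent:
  assumes "pair_graph G" "\<And>n. \<not> complete_digraph n (with_proj G)"
  shows "\<exists>x\<in>pverts G. \<exists>y\<in>pverts G. x \<noteq> y \<and> (x, y) \<notin> parcs G"
proof (rule ccontr)
  interpret pair_graph G by fact
  assume "\<not> ?thesis"
  then have "parcs G = {(u, v). (u, v) \<in> pverts G \<times> pverts G \<and> u \<noteq> v}"
    by (auto dest: in_arcsD1 in_arcsD2 no_loops')
  then have "complete_digraph (card (pverts G)) (with_proj G)"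
    unfolding complete_digraph_def using graph_axioms by simp
  then show False using assms(2) by blast
qed

section \<open>Degree bounds from minimality and toughness\<close>

text \<open>Let \<open>S\<close> violate \<open>t\<close>-toughness once the edge \<open>vu\<close>
  is deleted. Then \<open>S\<close> avoids \<open>u\<close> and \<open>v\<close>, and
  \<open>v\<close> still reaches everything left except \<open>u\<close>. So exactly two components
  remain, \<open>S\<close> has fewer than \<open>2 * t\<close> elements, and all neighbours of
  \<open>u\<close> lie in \<open>insert v S\<close>.\<close>

lemma minimally_tough_degree_less:
  fixes G :: "'a pair_pre_digraph"
  assumes "pair_graph G" "universal_vertex G v" "u \<in> pverts G" "u \<noteq> v" "t > 0"
    and tough: "tough t (with_proj G)"
    and less: "toughness (with_proj (delete_edge G (v, u))) < ereal t"
  shows "real (card {w. (u, w) \<in> parcs G}) < 2 * t + 1"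
proof -
  interpret pair_graph G by fact
  let ?D = "delete_edge G (v, u)"
  have pv: "pverts ?D = pverts G" and pa: "parcs ?D = parcs G - {(v, u), (u, v)}"
    by (auto simp: delete_edge_def)
  have D: "pair_wf_digraph ?D"
    by unfold_locales (auto simp: pv pa in_arcsD1 in_arcsD2)
  interpret D: pair_wf_digraph ?D by (rule D)
  have v: "v \<in> pverts G" "\<And>w. w \<in> pverts G \<Longrightarrow> w \<noteq> v \<Longrightarrow> (v, w) \<in> parcs G"
    using assms(2) unfolding universal_vertex_def by auto
  have fin: "finite (pverts G)" by simp
  \<comment> \<open>In \<open>?D\<close> the vertices \<open>v\<close> and \<open>u\<close> are not
    adjacent, so its toughness is a real number that bounds all admissible values.\<close>
  have "\<not> tough t (with_proj ?D)"
    using nonadjacent_imp_toughness[OF D, of v u] less fin v(1) assms(3,4) unfolding pv pa by auto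
  then obtain S where S: "S \<subseteq> pverts G"
    and nc: "num_components (with_proj ?D \<restriction> (pverts G - S)) > 1"
    and lt: "real (card S) < t * real (num_components (with_proj ?D \<restriction> (pverts G - S)))"
    unfolding tough_def with_proj_simps pv by (meson not_le)
  define T where "T = pverts G - S"
  let ?H = "with_proj ?D \<restriction> T"
  \<comment> \<open>If \<open>S\<close> contained an end of the deleted edge, the remaining graph
    would be the same as in \<open>G\<close>, which is \<open>t\<close>-tough.\<close>
  have uv: "u \<in> T" "v \<in> T"
  proof -
    have "u \<in> T \<and> v \<in> T"
    proof (rule ccontr)
      assume "\<not> (u \<in> T \<and> v \<in> T)"
      then have "?H = with_proj G \<restriction> T"
        unfolding induce_subgraph_def by (auto simp: pa)
      then show False
        using tough S nc lt unfolding tough_def T_def by auto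
    qed
    then show "u \<in> T" "v \<in> T" by auto
  qed
  have H: "wf_digraph ?H" by (rule D.wellformed_induce_subgraph)
  interpret H: wf_digraph ?H by (rule H)
  have sym: "symmetric ?H"
    unfolding symmetric_def
    by (rule symI) (auto simp: arcs_ends_induce_with_proj pa arcs_symmetric)
  have reach: "v \<rightarrow>\<^sup>*\<^bsub>?H\<^esub> w" if "w \<in> T" "w \<noteq> u" for w
  proof (cases "w = v")
    case True
    then show ?thesis using uv by simp
  next
    case False
    then have "(v, w) \<in> arcs_ends ?H"
      using that uv v(2)[of w] by (auto simp: arcs_ends_induce_with_proj pa T_def)
    then show ?thesis by (rule H.reachable_adjI)
  qed
  \<comment> \<open>A neighbour of \<open>u\<close> elsewhere would link \<open>u\<close> to
    \<open>v\<close>, leaving a single component.\<close>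
  have nbs: "w \<in> insert v S" if w: "(u, w) \<in> parcs G" for w
  proof (rule ccontr)
    assume n: "w \<notin> insert v S"
    then have wT: "w \<in> T" using in_arcsD2[OF w] unfolding T_def by blast
    have wu: "w \<noteq> u" using no_loops'[OF w] by blast
    have "(w, u) \<in> arcs_ends ?H"
      using arcs_symmetric[OF w] wT uv n wu by (auto simp: arcs_ends_induce_with_proj pa)
    then have "v \<rightarrow>\<^sup>*\<^bsub>?H\<^esub> u" using reach[OF wT wu] H.reachable_adj_trans by blast
    then have "num_components ?H \<le> Suc (card ({} :: 'a set))"
      using reach by (intro num_components_le[where v = v and X = "{}", OF H sym]) auto
    then show False using nc unfolding T_def by simp
  qed
  have "num_components ?H \<le> Suc (card {u})"
    using reach by (intro num_components_le[where v = v and X = "{u}", OF H sym]) auto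
  then have "num_components ?H = 2" using nc unfolding T_def by simp
  then have "real (card S) < 2 * t" using lt unfolding T_def by simp
  \<comment> \<open>The vertex \<open>v\<close> is the only neighbour of \<open>u\<close> that can
    lie outside \<open>S\<close>; it accounts for the summand 1 in the bound.\<close>
  moreover have "card {w. (u, w) \<in> parcs G} \<le> card (insert v S)"
    by (rule card_mono) (use nbs finite_subset[OF S] in auto)
  moreover have "card (insert v S) \<le> Suc (card S)" by (rule card_insert_le_m1) auto
  ultimately show ?thesis by linarith
qed

text \<open>The neighbourhood of \<open>u\<close> is a cutset: its removal isolates \<open>u\<close>
  from \<open>x\<close>.\<close>

lemma tough_degree_ge:
  fixes G :: "'a pair_pre_digraph"
  assumes "pair_graph G" "tough t (with_proj G)" "t \<ge> 0"
    and "u \<in> pverts G" "x \<in> pverts G" "x \<noteq> u" "(u, x) \<notin> parcs G"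
  shows "2 * t \<le> real (card {w. (u, w) \<in> parcs G})"
proof -
  interpret pair_graph G by fact
  define N where "N = {w. (u, w) \<in> parcs G}"
  let ?H = "with_proj G \<restriction> (pverts G - N)"
  have "N \<subseteq> pverts G" unfolding N_def using in_arcsD2 by blast
  have "u \<notin> N" "x \<notin> N" using no_loops' assms(7) unfolding N_def by auto
  then have "num_components ?H > 1"
    by (intro num_components_gt_1[where x = u and y = x and A = "{u}", OF wellformed_induce_subgraph])
      (use assms in \<open>auto simp: arcs_ends_induce_with_proj N_def\<close>)
  then have "t * real (num_components ?H) \<le> real (card N)" "2 \<le> num_components ?H"
    using assms(2) \<open>N \<subseteq> pverts G\<close> unfolding tough_def by auto
  moreover have "t * 2 \<le> t * real (num_components ?H)"
    using \<open>2 \<le> num_components ?H\<close> assms(3) by (intro mult_left_mono) auto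
  ultimately show ?thesis unfolding N_def by linarith
qed

section \<open>Regularity of \<open>G - v\<close> and the cutset \<open>{v}\<close>\<close>

theorem corollary4p9:
  fixes t :: real
  assumes "t \<in> \<rat>" and "t > 1/2"
  shows "\<not> (\<exists>G :: 'a pair_pre_digraph. pair_graph G \<and> minimally_tough t G \<and> wheel_free G \<and>
           (\<exists>v. universal_vertex G v))"
proof
  assume "\<exists>G :: 'a pair_pre_digraph. pair_graph G \<and> minimally_tough t G \<and> wheel_free G \<and>
    (\<exists>v. universal_vertex G v)"
  then obtain G :: "'a pair_pre_digraph" and v where G: "pair_graph G"
    and min: "minimally_tough t G" and wf: "wheel_free G" and univ: "universal_vertex G v"
    by blast
  interpret pair_graph G by (rule G)
  define N where "N u = {w. (u, w) \<in> parcs G}" for u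
  have N_sub: "N u \<subseteq> pverts G" for u unfolding N_def using in_arcsD2 by blast
  have fin: "finite (pverts G)" by simp
  have not_in_N: "u \<notin> N u" for u unfolding N_def using no_loops' by blast
  have fin_N: "finite (N u)" for u using finite_subset[OF N_sub fin] .
  have toughness: "toughness (with_proj G) = ereal t"
    and del: "\<And>e. e \<in> parcs G \<Longrightarrow> toughness (with_proj (delete_edge G e)) < ereal t"
    using min unfolding minimally_tough_def by auto
  have v: "v \<in> pverts G" and v_adj: "\<And>u. u \<in> pverts G \<Longrightarrow> u \<noteq> v \<Longrightarrow> (v, u) \<in> parcs G"
    using univ unfolding universal_vertex_def by auto
  have "\<not> complete_digraph n (with_proj G)" for n
    using toughness unfolding toughness_def by (auto split: if_splits)
  then obtain x0 y0 where xy: "x0 \<in> pverts G" "y0 \<in> pverts G" "x0 \<noteq> y0" "(x0, y0) \<notin> parcs G"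
    using not_complete_imp_nonadjacent[OF G] by blast
  have tough: "tough t (with_proj G)"
    using nonadjacent_imp_toughness[OF pair_wf_digraph fin xy] toughness by auto
  have lower: "2 * t \<le> real (card (N u))"
    if "u \<in> pverts G" "x \<in> pverts G" "x \<noteq> u" "(u, x) \<notin> parcs G" for u x
    unfolding N_def using tough_degree_ge[OF G tough _ that] assms(2) by simp
  have upper: "real (card (N u)) < 2 * t + 1" if "u \<in> pverts G" "u \<noteq> v" for u
    unfolding N_def using minimally_tough_degree_less[OF G univ that _ tough del] v_adj[OF that] assms(2)
    by simp
  \<comment> \<open>A second universal vertex \<open>u\<close> has degree at least
    \<open>card (pverts G) - 1\<close>, while \<open>x0\<close> misses both itself and
    \<open>y0\<close>. So the degree of \<open>u\<close> exceeds that of \<open>x0\<close>, which is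
    at least \<open>2 * t\<close>, and this contradicts \<open>upper\<close>.\<close>
  have nonuniv: "\<exists>x\<in>pverts G. x \<noteq> u \<and> (u, x) \<notin> parcs G" if u: "u \<in> pverts G" "u \<noteq> v" for u
  proof (rule ccontr)
    assume "\<not> ?thesis"
    then have "pverts G - {u} \<subseteq> N u" unfolding N_def by blast
    then have "card (pverts G - {u}) \<le> card (N u)" by (rule card_mono[OF fin_N])
    then have "card (pverts G) - 1 \<le> card (N u)" using u(1) fin by simp
    moreover have "N x0 \<subseteq> pverts G - {x0, y0}"
      using N_sub no_loops' xy(4) unfolding N_def by blast
    then have "card (N x0) \<le> card (pverts G - {x0, y0})" by (rule card_mono[rotated]) simp
    then have "card (N x0) \<le> card (pverts G) - 2" using xy(1-3) by (simp add: card_Diff_subset)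
    moreover have "2 \<le> card (pverts G)"
      using card_mono[of "pverts G" "{x0, y0}"] xy(1-3) by simp
    ultimately have "card (N x0) + 1 \<le> card (N u)" by linarith
    then show False using lower[OF xy(1,2)] xy(3,4) upper[OF u] by fastforce
  qed
  have regular: "card (N u) = card (N w)"
    if "u \<in> pverts G - {v}" "w \<in> pverts G - {v}" for u w
  proof -
    \<comment> \<open>Both degrees lie in the half-open interval from \<open>2 * t\<close> to
      \<open>2 * t + 1\<close>, which contains just one integer.\<close>
    have "2 * t \<le> real (card (N u))" "2 * t \<le> real (card (N w))"
      using nonuniv lower that by blast+
    moreover have "real (card (N u)) < 2 * t + 1" "real (card (N w)) < 2 * t + 1"
      using upper that by blast+
    ultimately show ?thesis by linarith
  qed
  have "sym (parcs G)" using arcs_symmetric by (auto intro: symI)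
  moreover have "irrefl (parcs G)" using no_loops' by (auto simp: irrefl_def)
  moreover have "finite (pverts G - {v})" "pverts G - {v} \<noteq> {}" using fin xy(1-3) by auto
  ultimately have "\<exists>x\<in>pverts G - {v}. \<forall>y\<in>pverts G - {v}. \<forall>z\<in>pverts G - {v}.
      (x, y) \<in> parcs G \<longrightarrow> (x, z) \<in> parcs G \<longrightarrow> y \<noteq> z \<longrightarrow> (y, z) \<in> parcs G"
    by (rule simplicial_vertex_exists) (rule wheel_free_imp_no_induced_cycle[OF G wf univ])
  then obtain x where x: "x \<in> pverts G - {v}"
    and simplicial: "\<And>y z. \<lbrakk>y \<in> pverts G - {v}; z \<in> pverts G - {v}; (x, y) \<in> parcs G;
      (x, z) \<in> parcs G; y \<noteq> z\<rbrakk> \<Longrightarrow> (y, z) \<in> parcs G"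
    by blast
  define A where "A = insert x (N x) - {v}"
  have closed: "b \<in> A" if a: "a \<in> A" and b: "(a, b) \<in> parcs G" "b \<noteq> v" for a b
  proof (cases "a = x")
    case True
    then show ?thesis using b unfolding A_def N_def by simp
  next
    case False
    then have xa: "(x, a) \<in> parcs G" "a \<in> pverts G - {v}"
      using a N_sub unfolding A_def N_def by auto
    \<comment> \<open>Since \<open>x\<close> is simplicial and \<open>v\<close> is universal, the
      closed neighbourhood of \<open>x\<close> lies in that of \<open>a\<close>. Regularity makes
      the two equal, so no edge leaves \<open>A\<close> except to \<open>v\<close>.\<close>
    have "insert x (N x) \<subseteq> insert a (N a)"
    proof
      fix z assume z: "z \<in> insert x (N x)"
      consider "z = x" | "z = v" | "z = a" | "z \<in> pverts G - {v}" "(x, z) \<in> parcs G" "a \<noteq> z"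
        using z N_sub unfolding N_def by blast
      then show "z \<in> insert a (N a)"
        by cases (use xa simplicial v_adj arcs_symmetric in \<open>auto simp: N_def\<close>)
    qed
    moreover have "card (insert x (N x)) = card (insert a (N a))"
      using regular[OF x xa(2)] fin_N not_in_N by simp
    ultimately have "insert x (N x) = insert a (N a)"
      using fin_N by (intro card_subset_eq) auto
    then show ?thesis using b unfolding A_def N_def by blast
  qed
  \<comment> \<open>As \<open>x\<close> is not universal, some vertex other than \<open>v\<close>
    lies outside \<open>A\<close>. Hence deleting \<open>v\<close> alone disconnects the
    graph.\<close>
  obtain z where z: "z \<in> pverts G" "z \<noteq> x" "(x, z) \<notin> parcs G" using nonuniv[of x] x by auto
  then have "z \<noteq> v" using x v_adj[of x] arcs_symmetric[of v x] by auto
  let ?H = "with_proj G \<restriction> (pverts G - {v})"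
  have "num_components ?H > 1"
    using x z \<open>z \<noteq> v\<close> closed
    by (intro num_components_gt_1[where x = x and y = z and A = A, OF wellformed_induce_subgraph])
      (auto simp: A_def N_def arcs_ends_induce_with_proj)
  then have "t * real (num_components ?H) \<le> 1" "2 \<le> num_components ?H"
    using tough v unfolding tough_def by auto
  moreover have "t * 2 \<le> t * real (num_components ?H)"
    using \<open>2 \<le> num_components ?H\<close> assms(2) by (intro mult_left_mono) auto
  ultimately show False using assms(2) by linarith
qed

end
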